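(* Let $G'$ be a triangulation of $S^2$ with exactly two odd vertices. Then $G'$ admits exactly one nontrivial $\mathbb{Z}_2$-coloring.
   Context: A triangulation of $S^2$ here means the dual of a finite connected bridgeless trivalent graph $G$ embedded in $S^2$: its vertices correspond to the regions of $G$, its edges to the edges of $G$, its triangles to the vertices of $G$; multiple edges are allowed, and the three vertices of each triangle are distinct. A vertex of the triangulation is odd if its degree is odd and even if its degree is even. A $\mathbb{Z}_2$-coloring of $G'$ is a map $c:V(G')\to\mathbb{Z}_2=\{0,1\}$ such that for each triangle of $G'$ the sum of the colors of its three vertices equals $0$ mod $2$. The trivial coloring is the one assigning $0$ to all vertices; any other $\mathbb{Z}_2$-coloring is nontrivial. *)

theory Defs
  imports
    "Graph_Theory.Graph_Theory"
    "HOL-Combinatorics.Orbits"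
    "HOL-Library.FuncSet"
    "HOL-Library.Z2"
begin

text \<open>
  A finite graph embedded in an oriented closed surface is given as a combinatorial map. Every
  edge of \<open>G\<close> is a pair of mutually reverse arcs \<open>a\<close>, \<open>arev a\<close> (loops and parallel edges are
  possible), and \<open>rot\<close> sends each arc to the next one, in the counterclockwise order, among the
  arcs leaving the same vertex.

  Follow \<open>a\<close>, and at its head continue with the arc after \<open>arev a\<close> in the rotation: this walks
  along the boundary of the region lying to the right of \<open>a\<close>. Hence the regions are the orbits
  of \<open>rot \<circ> arev\<close>; the region of \<open>a\<close> is the one to the right of \<open>a\<close>, and \<open>region arev rot (arev a)\<close>
  is the one to its left. At the tail of \<open>a\<close>, the region of \<open>a\<close> occupies the corner between \<open>a\<close>
  and the preceding arc of the rotation, so the arcs leaving a vertex correspond to the corners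
  at that vertex.
\<close>

definition region :: "('b \<Rightarrow> 'b) \<Rightarrow> ('b \<Rightarrow> 'b) \<Rightarrow> 'b \<Rightarrow> 'b set" where
  "region arev rot a = orbit (rot \<circ> arev) a"

definition regions :: "('a, 'b) pre_digraph \<Rightarrow> ('b \<Rightarrow> 'b) \<Rightarrow> ('b \<Rightarrow> 'b) \<Rightarrow> 'b set set" where
  "regions G arev rot = region arev rot ` arcs G"

definition edges :: "('a, 'b) pre_digraph \<Rightarrow> ('b \<Rightarrow> 'b) \<Rightarrow> 'b set set" where
  "edges G arev = (\<lambda>a. {a, arev a}) ` arcs G"

text \<open>
  Gluing a disc along each orbit of \<open>rot \<circ> arev\<close> turns a connected combinatorial map into a closed
  connected oriented surface. By the classification of surfaces it is the sphere iff its Euler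
  characteristic is 2. Conversely, the regions of a connected graph embedded in the sphere are
  open discs, so the embedding is determined by its combinatorial map. A graph consisting of one
  vertex and no edge is not covered by the Euler formula as stated here (it has no arc to carry its
  region); this does not matter for trivalent graphs.
\<close>

locale sphere_embedded_graph = fin_digraph G + bidirected_digraph G arev
  for G :: "('a, 'b) pre_digraph" and arev :: "'b \<Rightarrow> 'b" +
  fixes rot :: "'b \<Rightarrow> 'b"
  assumes connected_graph: "connected G"
    and rot_permutes: "rot permutes arcs G"
    and rot_cyclic: "\<And>v. v \<in> verts G \<Longrightarrow> out_arcs G v \<noteq> {} \<Longrightarrow> cyclic_on rot (out_arcs G v)"
    and euler_characteristic:
      "int (card (verts G)) - int (card (edges G arev)) + int (card (regions G arev rot)) = 2"

definition trivalent :: "('a, 'b) pre_digraph \<Rightarrow> bool" where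
  "trivalent G \<longleftrightarrow> (\<forall>v \<in> verts G. out_degree G v = 3)"

definition bridgeless :: "('a, 'b) pre_digraph \<Rightarrow> ('b \<Rightarrow> 'b) \<Rightarrow> bool" where
  "bridgeless G arev \<longleftrightarrow>
    (\<forall>a \<in> arcs G. connected (G\<lparr>arcs := arcs G - {a, arev a}\<rparr>))"

text \<open>
  The 1-skeleton of the dual: the edge dual to \<open>{a, arev a}\<close> joins the regions on both sides of
  that edge. It is again given by the two arcs \<open>a\<close> and \<open>arev a\<close>, so the degree of a vertex is its
  out-degree.
\<close>

definition dual_graph ::
  "('a, 'b) pre_digraph \<Rightarrow> ('b \<Rightarrow> 'b) \<Rightarrow> ('b \<Rightarrow> 'b) \<Rightarrow> ('b set, 'b) pre_digraph" where
  "dual_graph G arev rot =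
    \<lparr>verts = regions G arev rot, arcs = arcs G,
     tail = region arev rot, head = (\<lambda>a. region arev rot (arev a))\<rparr>"

text \<open>The vertex set of the triangle dual to the vertex \<open>v\<close> of \<open>G\<close>.\<close>

definition triangle ::
  "('a, 'b) pre_digraph \<Rightarrow> ('b \<Rightarrow> 'b) \<Rightarrow> ('b \<Rightarrow> 'b) \<Rightarrow> 'a \<Rightarrow> 'b set set" where
  "triangle G arev rot v = region arev rot ` out_arcs G v"

text \<open>
  The data \<open>G\<close>, \<open>arev\<close>, \<open>rot\<close> present the triangulation dual to the embedded graph. The last
  assumption follows from the others (an edge with the same region on both sides is a bridge);
  it is listed because it belongs to the description of a triangulation.
\<close>

locale sphere_triangulation = sphere_embedded_graph G arev rot
  for G :: "('a, 'b) pre_digraph" and arev rot :: "'b \<Rightarrow> 'b" +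
  assumes trivalent_graph: "trivalent G"
    and bridgeless_graph: "bridgeless G arev"
    and triangle_distinct: "\<And>v. v \<in> verts G \<Longrightarrow> card (triangle G arev rot v) = 3"

definition odd_vertices ::
  "('a, 'b) pre_digraph \<Rightarrow> ('b \<Rightarrow> 'b) \<Rightarrow> ('b \<Rightarrow> 'b) \<Rightarrow> 'b set set" where
  "odd_vertices G arev rot =
    {r \<in> verts (dual_graph G arev rot). odd (out_degree (dual_graph G arev rot) r)}"

text \<open>
  Colorings are extensional functions on the vertex set of the dual, so that distinct colorings
  differ at some vertex; \<open>bit\<close> is the field with two elements.
\<close>

definition Z2_colorings ::
  "('a, 'b) pre_digraph \<Rightarrow> ('b \<Rightarrow> 'b) \<Rightarrow> ('b \<Rightarrow> 'b) \<Rightarrow> ('b set \<Rightarrow> bit) set" where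
  "Z2_colorings G arev rot =
    {c \<in> verts (dual_graph G arev rot) \<rightarrow>\<^sub>E (UNIV :: bit set).
      \<forall>v \<in> verts G. (\<Sum>r \<in> triangle G arev rot v. c r) = 0}"

definition trivial_coloring ::
  "('a, 'b) pre_digraph \<Rightarrow> ('b \<Rightarrow> 'b) \<Rightarrow> ('b \<Rightarrow> 'b) \<Rightarrow> 'b set \<Rightarrow> bit" where
  "trivial_coloring G arev rot = (\<lambda>r \<in> verts (dual_graph G arev rot). 0)"

end

theory Submission
  imports Defs
begin

text \<open>
  A coloring gives the colors of one triangle as \<open>(0, 0, 0)\<close> or as some arrangement of
  \<open>(0, 1, 1)\<close>, and the colors of a triangle determine those of its neighbors. So everything is
  about transporting the colors of one triangle along paths of triangles. If the triangles around a
  vertex of color \<open>x\<close> are passed in order, the outer vertices get the colors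
  \<open>y\<close>, \<open>y + x\<close>, \<open>y + 2 x\<close>, and so on, so one full turn around a vertex of degree \<open>d\<close>
  changes \<open>y\<close> into \<open>y + d x\<close>. Hence the transport closes up around every even vertex, and around
  an odd vertex exactly if that vertex has color 0.

  For uniqueness (\<open>nontrivial_coloring_unique\<close>) take an odd vertex \<open>q\<close>. It must have
  color 0, so a triangle at \<open>q\<close> has the colors \<open>(0, 0, 0)\<close> or \<open>(0, 1, 1)\<close> with the 0 at \<open>q\<close>;
  the first alternative spreads to the trivial coloring, the second to at most one other coloring.

  For existence (\<open>nontrivial_coloring_exists\<close>), transport \<open>(0, 1, 1)\<close> from a triangle at \<open>q\<close>,
  with the 0 at \<open>q\<close>, along a spanning tree \<open>T\<close> of \<open>G\<close>. On the sphere the edges of \<open>G\<close>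
  outside \<open>T\<close> form a spanning tree of the graph whose nodes are the regions (\<open>tree_cotree\<close>): they
  connect the regions because \<open>T\<close> is acyclic, and by the Euler formula there are exactly as many
  of them as such a tree needs. Root this second tree at the other odd vertex \<open>p\<close> and remove leaves
  one after another. At a leaf \<open>r\<close>, the colors are already known to agree across all edges around
  \<open>r\<close> but one, and going around \<open>r\<close> shows that they agree across the last one
  (\<open>close_up_region\<close>), because \<open>r\<close> is even or it is \<open>q\<close>. The root \<open>p\<close> is never a leaf to be
  removed, so its odd degree does no harm.

  Topologically, the fundamental group of the sphere without \<open>p\<close> and \<open>q\<close> is generated
  by a loop around \<open>q\<close>, and this loop acts on the four colorings of a triangle by a
  transvection, which fixes exactly one nonzero element.

  Colors are transported as functions on the arcs of \<open>G\<close>: the arc \<open>a\<close> stands for the corner of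
  \<open>region arev rot a\<close> at the tail of \<open>a\<close>. This allows a region to have different colors at
  different corners as long as agreement has not been shown.
\<close>

section \<open>Rooted spanning trees given by parent arcs\<close>

text \<open>
  Every node other than the root has a parent arc, which leads to it from a node of smaller rank.
  This replaces paths and cycles: a node of maximal rank is a leaf of the tree, and every argument
  about the tree is an induction on the rank or a look at such a node. Both directions \<open>a\<close> and
  \<open>rev a\<close> of a tree edge are counted as tree arcs.
\<close>

locale rooted_spanning_tree =
  fixes N :: "'n set" and r :: 'n and A :: "'b set" and t h :: "'b \<Rightarrow> 'n"
    and rev :: "'b \<Rightarrow> 'b" and parent :: "'n \<Rightarrow> 'b" and rank :: "'n \<Rightarrow> nat"
  assumes finite_nodes: "finite N"
    and root_in: "r \<in> N"
    and rev_in: "\<And>a. a \<in> A \<Longrightarrow> rev a \<in> A"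
    and rev_rev: "\<And>a. a \<in> A \<Longrightarrow> rev (rev a) = a"
    and t_rev: "\<And>a. a \<in> A \<Longrightarrow> t (rev a) = h a"
    and parent_in: "\<And>x. x \<in> N - {r} \<Longrightarrow> parent x \<in> A"
    and h_parent: "\<And>x. x \<in> N - {r} \<Longrightarrow> h (parent x) = x"
    and t_parent: "\<And>x. x \<in> N - {r} \<Longrightarrow> t (parent x) \<in> N"
    and rank_parent: "\<And>x. x \<in> N - {r} \<Longrightarrow> rank (t (parent x)) < rank x"
begin

definition tree_arcs :: "'b set" where
  "tree_arcs = parent ` (N - {r}) \<union> rev ` parent ` (N - {r})"

lemma tree_arcs_subset: "tree_arcs \<subseteq> A"
  unfolding tree_arcs_def using parent_in rev_in by auto

lemma rev_tree_arcs: "a \<in> tree_arcs \<Longrightarrow> rev a \<in> tree_arcs"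
  unfolding tree_arcs_def using parent_in rev_rev by auto

text \<open>
  The tree edges at a node are the edge to its parent and edges to nodes of larger rank. Thus if
  the nodes of larger rank have been dealt with, a single edge is left.
\<close>

lemma tree_arc_from_cases:
  assumes "a \<in> tree_arcs"
  obtains (up) "t a \<in> N - {r}" "a = rev (parent (t a))"
    | (down) y where "y \<in> N - {r}" "a = parent y" "rank (t a) < rank y"
proof -
  consider x where "x \<in> N - {r}" "a = rev (parent x)" | x where "x \<in> N - {r}" "a = parent x"
    using assms unfolding tree_arcs_def by blast
  then show thesis
  proof cases
    case 1
    then show thesis using up by (simp add: t_rev parent_in h_parent)
  next
    case 2
    then show thesis using down rank_parent by blast
  qed
qed

lemma card_tree_arcs: "card tree_arcs = 2 * (card N - 1)"
proof -
  have inj: "inj_on parent (N - {r})"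
    by (rule inj_on_inverseI[of _ h]) (rule h_parent)
  have "inj_on rev (parent ` (N - {r}))"
    by (rule inj_on_inverseI[of _ rev]) (use rev_rev parent_in in auto)
  then have card: "card (parent ` (N - {r})) = card N - 1"
      "card (rev ` parent ` (N - {r})) = card N - 1"
    using inj by (simp_all add: card_image finite_nodes root_in)
  have "parent ` (N - {r}) \<inter> rev ` parent ` (N - {r}) = {}"
  proof (rule ccontr)
    assume "\<not> ?thesis"
    then obtain x y where x: "x \<in> N - {r}" and y: "y \<in> N - {r}" and eq: "parent x = rev (parent y)"
      by blast
    \<comment> \<open>If one arc were the parent arc of \<open>x\<close> and its reverse that of \<open>y\<close>, each of the two
      nodes would have a smaller rank than the other.\<close>
    have "t (parent x) = y"
      using eq y by (simp add: t_rev parent_in h_parent)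
    moreover have "t (parent y) = x"
      using eq x y by (metis h_parent parent_in rev_rev t_rev)
    ultimately show False
      using rank_parent[OF x] rank_parent[OF y] by simp
  qed
  then show ?thesis
    unfolding tree_arcs_def using card finite_nodes by (subst card_Un_disjoint) auto
qed

text \<open>
  A value prescribed at the root extends along the tree by an arbitrary transport rule.
\<close>

lemma tree_recursion:
  "\<exists>\<sigma>. \<sigma> r = s0 \<and> (\<forall>x \<in> N - {r}. \<sigma> x = F x (\<sigma> (t (parent x))))"
proof -
  define H where "H = (\<lambda>\<sigma> x. if x \<in> N - {r} then F x (\<sigma> (t (parent x))) else s0)"
  have "wfrec (measure rank) H x = H (wfrec (measure rank) H) x" for x
    by (subst wfrec[OF wf_measure]) (auto simp: H_def cut_def rank_parent)
  then show ?thesis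
    by (intro exI[of _ "wfrec (measure rank) H"]) (auto simp: H_def)
qed

end

text \<open>
  The distance from the root serves as the rank, and the parent arc of a node is the last arc of a
  shortest path to it.
\<close>

lemma rooted_spanning_tree_exists:
  fixes t h :: "'b \<Rightarrow> 'n" and rev :: "'b \<Rightarrow> 'b"
  assumes "finite N" "r \<in> N"
    and rev: "\<And>a. a \<in> A \<Longrightarrow> rev a \<in> A" "\<And>a. a \<in> A \<Longrightarrow> rev (rev a) = a"
      "\<And>a. a \<in> A \<Longrightarrow> t (rev a) = h a"
    and ends: "\<And>a. a \<in> A \<Longrightarrow> t a \<in> N" "\<And>a. a \<in> A \<Longrightarrow> h a \<in> N"
    and connected: "\<And>X. r \<in> X \<Longrightarrow> X \<subseteq> N \<Longrightarrow> (\<And>a. a \<in> A \<Longrightarrow> t a \<in> X \<Longrightarrow> h a \<in> X) \<Longrightarrow> X = N"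
  shows "\<exists>parent rank. rooted_spanning_tree N r A t h rev parent rank"
proof -
  define R where "R = (\<lambda>a. (t a, h a)) ` A"
  have "{x \<in> N. (r, x) \<in> R\<^sup>*} = N"
    by (rule connected) (use assms(2) ends in \<open>auto simp: R_def intro: rtrancl_into_rtrancl\<close>)
  then have reach: "\<exists>n. (r, x) \<in> R ^^ n" if "x \<in> N" for x
    using that rtrancl_imp_relpow by blast
  define rank where "rank = (\<lambda>x. LEAST n. (r, x) \<in> R ^^ n)"
  have "\<exists>a \<in> A. h a = x \<and> rank (t a) < rank x" if x: "x \<in> N - {r}" for x
  proof -
    have path: "(r, x) \<in> R ^^ rank x"
      unfolding rank_def using reach x by (metis DiffD1 LeastI)
    then obtain n where n: "rank x = Suc n"
      using x by (cases "rank x") auto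
    then obtain y where y: "(r, y) \<in> R ^^ n" "(y, x) \<in> R"
      using path by auto
    then have "rank y \<le> n"
      unfolding rank_def by (intro Least_le)
    then show ?thesis
      using y n by (auto simp: R_def)
  qed
  then obtain parent where "\<And>x. x \<in> N - {r} \<Longrightarrow>
      parent x \<in> A \<and> h (parent x) = x \<and> rank (t (parent x)) < rank x"
    by metis
  then have "rooted_spanning_tree N r A t h rev parent rank"
    using assms(1,2) rev ends by unfold_locales auto
  then show ?thesis by blast
qed

section \<open>Regions and corners\<close>

context sphere_embedded_graph
begin

abbreviation "reg \<equiv> region arev rot"

lemma rot_in_arcs [simp]: "rot a \<in> arcs G \<longleftrightarrow> a \<in> arcs G"
  using rot_permutes by (rule permutes_in_image)

lemma next_permutes: "rot \<circ> arev permutes arcs G"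
  using arev_permutes_arcs rot_permutes by (rule permutes_compose)

lemma next_permutation: "permutation (rot \<circ> arev)"
  using next_permutes finite_arcs unfolding permutation_permutes by blast

lemma in_reg: "a \<in> reg a"
  unfolding region_def by (rule permutation_self_in_orbit[OF next_permutation])

lemma reg_subset: "a \<in> arcs G \<Longrightarrow> reg a \<subseteq> arcs G"
  unfolding region_def by (rule permutes_orbit_subset[OF next_permutes])

lemma reg_eq_iff: "reg a = reg b \<longleftrightarrow> a \<in> reg b"
  unfolding region_def
  by (metis cyclic_on_orbit'[OF next_permutation] in_reg orbit_cyclic_eq3 region_def)

lemma reg_rot_arev: "reg (rot (arev a)) = reg a"
  unfolding region_def using permutation_orbit_step[OF next_permutation, of a] by simp

lemma reg_rot: "reg (rot a) = reg (arev a)"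
  using reg_rot_arev[of "arev a"] by simp

lemma reg_in_regions: "a \<in> arcs G \<Longrightarrow> reg a \<in> regions G arev rot"
  by (simp add: regions_def)

lemma finite_regions: "finite (regions G arev rot)"
  by (simp add: regions_def)

text \<open>
  A region is the set of its corners, so its size is the degree of the dual vertex.
\<close>

lemma out_degree_dual:
  assumes "a \<in> arcs G"
  shows "out_degree (dual_graph G arev rot) (reg a) = card (reg a)"
proof -
  have "out_arcs (dual_graph G arev rot) (reg a) = reg a"
    using reg_subset[OF assms] by (auto simp: out_arcs_def dual_graph_def reg_eq_iff)
  then show ?thesis by (simp add: out_degree_def)
qed

lemma verts_dual: "verts (dual_graph G arev rot) = regions G arev rot"
  by (simp add: dual_graph_def)

lemma odd_vertices_iff:
  "a \<in> arcs G \<Longrightarrow> reg a \<in> odd_vertices G arev rot \<longleftrightarrow> odd (card (reg a))"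
  by (simp add: odd_vertices_def verts_dual reg_in_regions out_degree_dual)

lemma card_arcs: "card (arcs G) = 2 * card (edges G arev)"
proof -
  have "card (\<Union>(edges G arev)) = sum card (edges G arev)"
    by (rule card_Union_disjoint)
      (auto simp: edges_def pairwise_def disjnt_def arev_eq_iff)
  also have "\<Union>(edges G arev) = arcs G"
    by (auto simp: edges_def)
  also have "sum card (edges G arev) = sum (\<lambda>_. 2) (edges G arev)"
    by (intro sum.cong) (auto simp: edges_def card_insert_if dest: arev_neq)
  finally show ?thesis by simp
qed

lemma connected_induct:
  assumes "v \<in> verts G" "P v" and step: "\<And>a. a \<in> arcs G \<Longrightarrow> P (tail G a) \<Longrightarrow> P (head G a)"
    and "w \<in> verts G"
  shows "P w"
proof -
  \<comment> \<open>Arcs come in reverse pairs, so connectedness gives directed paths.\<close>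
  have "strongly_connected G"
    by (rule symmetric_connected_imp_strongly_connected[OF sym_arcs connected_graph])
  then have "v \<rightarrow>\<^sup>*\<^bsub>G\<^esub> w"
    using assms by blast
  then show ?thesis
    by (induction rule: reachable_induct)
      (use \<open>P v\<close> step in \<open>auto simp: arcs_ends_def arc_to_ends_def\<close>)
qed

end

context sphere_triangulation
begin

text \<open>
  A cyclic permutation of three arcs: all later computations at a vertex use only this normal form.
\<close>

lemma corners:
  assumes a: "a \<in> arcs G"
  shows "out_arcs G (tail G a) = {a, rot a, rot (rot a)}"
    and "rot (rot (rot a)) = a"
    and "rot a \<noteq> a" "rot (rot a) \<noteq> a" "rot (rot a) \<noteq> rot a"
proof -
  let ?O = "out_arcs G (tail G a)"
  have "a \<in> ?O" using a by simp
  then have cyc: "cyclic_on rot ?O"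
    using rot_cyclic[of "tail G a"] tail_in_verts[OF a] by blast
  have card: "card ?O = 3"
    using trivalent_graph a by (auto simp: trivalent_def out_degree_def)
  have O: "?O = orbit rot a"
    using orbit_cyclic_eq3[OF cyc \<open>a \<in> ?O\<close>] by simp
  have self: "a \<in> orbit rot a" using O \<open>a \<in> ?O\<close> by simp
  let ?d = "funpow_dist1 rot a a"
  have img: "orbit rot a = (\<lambda>n. (rot ^^ n) a) ` {0..<?d}"
    by (rule orbit_conv_funpow_dist1[OF self])
  have inj: "inj_on (\<lambda>n. (rot ^^ n) a) {0..<?d}"
    by (rule inj_on_funpow_dist1[OF self])
  have "?d = 3"
    using card O img card_image[OF inj] by simp
  have set3: "{0..<3::nat} = {0, 1, 2}" by auto
  show "?O = {a, rot a, rot (rot a)}"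
    using O img unfolding \<open>?d = 3\<close> set3 by (simp add: numeral_2_eq_2)
  then have "card {a, rot a, rot (rot a)} = 3" using card by simp
  then show "rot a \<noteq> a" "rot (rot a) \<noteq> a" "rot (rot a) \<noteq> rot a"
    by (auto simp: card_insert_if split: if_splits)
  show "rot (rot (rot a)) = a"
    using funpow_dist1_prop[OF self] unfolding \<open>?d = 3\<close> by (simp add: numeral_3_eq_3)
qed

lemma tail_rot: "a \<in> arcs G \<Longrightarrow> tail G (rot a) = tail G a"
  using corners(1)[of a] by (metis in_out_arcs_conv insertCI)

text \<open>
  Here the three regions at a vertex must be distinct: the sum over the vertex set of a triangle
  would otherwise count a repeated region only once.
\<close>

lemma sum_triangle:
  assumes a: "a \<in> arcs G"
  shows "(\<Sum>R \<in> triangle G arev rot (tail G a). c R) =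
    c (reg a) + c (reg (rot a)) + (c (reg (rot (rot a))) :: bit)"
proof -
  have tri: "triangle G arev rot (tail G a) = {reg a, reg (rot a), reg (rot (rot a))}"
    by (simp add: triangle_def corners(1)[OF a])
  moreover have "card (triangle G arev rot (tail G a)) = 3"
    using a by (intro triangle_distinct) simp
  ultimately have "reg a \<noteq> reg (rot a)" "reg a \<noteq> reg (rot (rot a))"
      "reg (rot a) \<noteq> reg (rot (rot a))"
    by (auto simp: card_insert_if split: if_splits)
  then show ?thesis
    unfolding tri
    by (cases "c (reg a)"; cases "c (reg (rot a))"; cases "c (reg (rot (rot a)))") simp_all
qed

lemma exists_out_arc:
  assumes "v \<in> verts G"
  obtains a where "a \<in> arcs G" "tail G a = v"
proof -
  have "card (out_arcs G v) = 3"
    using trivalent_graph assms by (auto simp: trivalent_def out_degree_def)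
  then have "out_arcs G v \<noteq> {}" by auto
  then show ?thesis using that by (auto simp: out_arcs_def)
qed

section \<open>Colorings of corners\<close>

lemma of_nat_bit: "(of_nat n :: bit) = of_bool (odd n)"
  by (induction n) simp_all

text \<open>
  A coloring of corners that satisfies the triangle condition at every vertex of \<open>G\<close>, but in which
  the corners of one region may have different colors.
\<close>

definition corner_coloring :: "('b \<Rightarrow> bit) \<Rightarrow> bool" where
  "corner_coloring s \<longleftrightarrow> (\<forall>a \<in> arcs G. s a + s (rot a) + s (rot (rot a)) = 0)"

text \<open>
  Two regions meet along the edge of \<open>a\<close>. The region of \<open>a\<close> has the corner \<open>a\<close> at the tail and
  the corner \<open>rot (arev a)\<close> at the head; the region on the other side has the corner \<open>rot a\<close> at
  the tail and the corner \<open>arev a\<close> at the head. The condition says that both regions keep their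
  colors from one end of the edge to the other.
\<close>

definition agrees_across :: "('b \<Rightarrow> bit) \<Rightarrow> 'b \<Rightarrow> bool" where
  "agrees_across s a \<longleftrightarrow> s (rot (arev a)) = s a \<and> s (arev a) = s (rot a)"

lemma agrees_across_arev: "agrees_across s (arev a) \<longleftrightarrow> agrees_across s a"
  by (auto simp: agrees_across_def)

lemma corner_coloring_third:
  assumes "corner_coloring s" "a \<in> arcs G"
  shows "s (rot (rot a)) = s a + s (rot a)"
proof -
  have "s a + s (rot a) + s (rot (rot a)) = 0"
    using assms by (simp add: corner_coloring_def)
  then show ?thesis
    by (cases "s a"; cases "s (rot a)"; cases "s (rot (rot a))") simp_all
qed

text \<open>
  Agreement as a step of the walk around the region of \<open>a\<close>: this region keeps its color, and the
  color of the adjacent corner \<open>rot a\<close> increases by it.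
\<close>

lemma agrees_across_iff:
  assumes s: "corner_coloring s" and a: "a \<in> arcs G"
  shows "agrees_across s a \<longleftrightarrow>
    s (rot (arev a)) = s a \<and> s (rot (rot (arev a))) = s (rot a) + s a"
proof -
  have "s (rot (rot (arev a))) = s (arev a) + s (rot (arev a))"
    using corner_coloring_third[OF s, of "arev a"] a by simp
  then show ?thesis
    unfolding agrees_across_def
    by (cases "s a"; cases "s (rot a)"; cases "s (arev a)"; cases "s (rot (arev a))") simp_all
qed

lemma next_funpow_in_arcs: "a \<in> arcs G \<Longrightarrow> ((rot \<circ> arev) ^^ n) a \<in> arcs G"
  by (induction n) auto

lemma walk_around_region:
  assumes s: "corner_coloring s" and a: "a \<in> arcs G"
    and agree: "\<And>i. i < n \<Longrightarrow> agrees_across s (((rot \<circ> arev) ^^ i) a)"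
  shows "s (((rot \<circ> arev) ^^ n) a) = s a \<and>
    s (rot (((rot \<circ> arev) ^^ n) a)) = s (rot a) + of_nat n * s a"
  using agree
proof (induction n)
  case (Suc n)
  let ?b = "((rot \<circ> arev) ^^ n) a"
  have "agrees_across s ?b" using Suc.prems[of n] by blast
  then have b: "s (rot (arev ?b)) = s ?b" "s (rot (rot (arev ?b))) = s (rot ?b) + s ?b"
    using agrees_across_iff[OF s next_funpow_in_arcs[OF a]] by blast+
  have IH: "s ?b = s a" "s (rot ?b) = s (rot a) + of_nat n * s a"
    using Suc.IH Suc.prems less_SucI by blast+
  have "s (rot (rot (arev ?b))) = s (rot a) + of_nat (Suc n) * s a"
    unfolding b IH of_nat_Suc by (simp only: distrib_right mult_1_left add_ac)
  moreover have "((rot \<circ> arev) ^^ Suc n) a = rot (arev ?b)" by simp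
  ultimately show ?case
    using b(1) IH(1) by (simp only: simp_thms)
qed simp

lemma next_cycle:
  obtains d where "d > 0" "card (reg a) = d" "((rot \<circ> arev) ^^ d) a = a"
    "reg a = (\<lambda>i. ((rot \<circ> arev) ^^ i) a) ` {0..<d}"
    "inj_on (\<lambda>i. ((rot \<circ> arev) ^^ i) a) {0..<d}"
proof -
  have self: "a \<in> orbit (rot \<circ> arev) a"
    by (rule permutation_self_in_orbit[OF next_permutation])
  show ?thesis
    by (rule that[of "funpow_dist1 (rot \<circ> arev) a a"])
      (use funpow_dist1_prop[OF self] orbit_conv_funpow_dist1[OF self] inj_on_funpow_dist1[OF self]
        card_image[OF inj_on_funpow_dist1[OF self]] in \<open>simp_all add: region_def\<close>)
qed

text \<open>
  One full turn returns to the corner \<open>a\<close>, so \<open>y = y + d x\<close> for the degree \<open>d\<close>, the color \<open>x\<close>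
  of the region and the color \<open>y\<close> of its neighbor; for odd \<open>d\<close> this gives \<open>x = 0\<close>.
\<close>

lemma odd_region_corner_zero:
  assumes s: "corner_coloring s" and agree: "\<And>a. a \<in> arcs G \<Longrightarrow> agrees_across s a"
    and a: "a \<in> arcs G" and odd: "odd (card (reg a))"
  shows "s a = 0"
proof -
  obtain d where d: "card (reg a) = d" "((rot \<circ> arev) ^^ d) a = a"
    using next_cycle by metis
  have "s (rot a) = s (rot a) + of_nat d * s a"
    using walk_around_region[OF s a, of d] agree next_funpow_in_arcs[OF a] d by simp
  moreover have "(of_nat d :: bit) = 1"
    using odd d by (simp add: of_nat_bit)
  ultimately show ?thesis by (cases "s a"; cases "s (rot a)") simp_all
qed

text \<open>
  Walk from the far end of the edge of \<open>a\<close> all the way around the region back to \<open>a\<close>. These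
  \<open>d - 1\<close> steps keep the color \<open>x\<close> of the region and turn the color \<open>y'\<close> of its neighbor into
  \<open>y = y' + (d - 1) x\<close>. Agreement across the skipped edge means \<open>y' = y + x\<close>, that is, \<open>d x = 0\<close>.
\<close>

lemma close_up_region:
  assumes s: "corner_coloring s" and a: "a \<in> arcs G"
    and agree: "\<And>b. b \<in> reg a \<Longrightarrow> b \<noteq> a \<Longrightarrow> agrees_across s b"
    and good: "even (card (reg a)) \<or> (\<exists>b \<in> reg a. s b = 0)"
  shows "agrees_across s a"
proof -
  let ?f = "rot \<circ> arev"
  obtain d where d: "d > 0" "card (reg a) = d" "(?f ^^ d) a = a"
    and img: "reg a = (\<lambda>i. (?f ^^ i) a) ` {0..<d}"
    and inj: "inj_on (\<lambda>i. (?f ^^ i) a) {0..<d}"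
    by (rule next_cycle)
  let ?a' = "?f a"
  have shift: "(?f ^^ i) ?a' = (?f ^^ Suc i) a" for i
    by (simp only: funpow_Suc_right o_apply)
  have step: "agrees_across s ((?f ^^ i) ?a')" if "i < d - 1" for i
  proof (rule agree)
    have i: "Suc i \<in> {0..<d}" using that by auto
    show "(?f ^^ i) ?a' \<in> reg a"
      unfolding shift img using i by blast
    show "(?f ^^ i) ?a' \<noteq> a"
      unfolding shift using inj_onD[OF inj, of "Suc i" 0] i d(1) by fastforce
  qed
  have a': "?a' \<in> arcs G" using a by simp
  have walk: "s ((?f ^^ n) ?a') = s ?a' \<and> s (rot ((?f ^^ n) ?a')) = s (rot ?a') + of_nat n * s ?a'"
    if "n \<le> d - 1" for n
    using that by (intro walk_around_region[OF s a'] step) simp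
  have "(?f ^^ (d - 1)) ?a' = a"
    using d by (simp only: shift Suc_diff_1)
  then have around: "s a = s ?a'" "s (rot a) = s (rot ?a') + of_nat (d - 1) * s ?a'"
    using walk[of "d - 1"] by simp_all
  have "s b = s a" if b: "b \<in> reg a" for b
  proof -
    obtain i where "i < d" "b = (?f ^^ i) a"
      using b unfolding img by auto
    then show ?thesis
    proof (cases i)
      case (Suc j)
      then have "b = (?f ^^ j) ?a'" "j \<le> d - 1"
        using \<open>b = (?f ^^ i) a\<close> \<open>i < d\<close> by (simp_all only: shift)
      then show ?thesis using walk[of j] around(1) by metis
    qed (use \<open>b = (?f ^^ i) a\<close> in simp)
  qed
  then have "even d \<or> s a = 0"
    using good d by auto
  moreover have "(of_nat (d - 1) :: bit) = 1" if "even d"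
    using that d(1) by (simp add: of_nat_bit)
  ultimately have "s (rot ?a') = s (rot a) + s a"
    using around by (cases "s ?a'"; cases "s (rot ?a')"; cases "s (rot a)") auto
  then show ?thesis
    using around(1) by (simp add: agrees_across_iff[OF s a])
qed

text \<open>
  Two colors at a vertex of \<open>G\<close> determine the third, and agreement across an edge carries two
  colors to its other end; \<open>G\<close> is connected.
\<close>

lemma corner_coloring_determined:
  assumes s: "corner_coloring s" "\<And>a. a \<in> arcs G \<Longrightarrow> agrees_across s a"
    and s': "corner_coloring s'" "\<And>a. a \<in> arcs G \<Longrightarrow> agrees_across s' a"
    and a: "a \<in> arcs G" and start: "s a = s' a" "s (rot a) = s' (rot a)"
    and b: "b \<in> arcs G"
  shows "s b = s' b"
proof -
  have same: "\<forall>y \<in> out_arcs G (tail G x). s y = s' y"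
    if "x \<in> arcs G" "s x = s' x" "s (rot x) = s' (rot x)" for x
    using that corner_coloring_third[OF s(1)] corner_coloring_third[OF s'(1)]
    by (simp add: corners(1))
  have "\<forall>y \<in> out_arcs G (tail G b). s y = s' y"
  proof (rule connected_induct[where P = "\<lambda>v. \<forall>y \<in> out_arcs G v. s y = s' y"])
    show "\<forall>y \<in> out_arcs G (tail G a). s y = s' y"
      using same a start by blast
    fix x assume x: "x \<in> arcs G" "\<forall>y \<in> out_arcs G (tail G x). s y = s' y"
    then have "s x = s' x" "s (rot x) = s' (rot x)"
      by (simp_all add: corners(1))
    then have "s (arev x) = s' (arev x)" "s (rot (arev x)) = s' (rot (arev x))"
      using s(2)[OF x(1)] s'(2)[OF x(1)] by (simp_all add: agrees_across_def)
    then show "\<forall>y \<in> out_arcs G (head G x). s y = s' y"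
      using same[of "arev x"] x(1) by simp
  qed (use a b in simp_all)
  then show ?thesis using b by simp
qed

section \<open>Colorings of the triangulation as colorings of corners\<close>

lemma corner_coloring_of_coloring:
  assumes "c \<in> Z2_colorings G arev rot"
  shows "corner_coloring (\<lambda>a. c (reg a))" and "agrees_across (\<lambda>a. c (reg a)) a"
proof -
  have "c (reg a) + c (reg (rot a)) + c (reg (rot (rot a))) = 0" if "a \<in> arcs G" for a
    using assms that sum_triangle[OF that, of c] by (auto simp: Z2_colorings_def)
  then show "corner_coloring (\<lambda>a. c (reg a))"
    unfolding corner_coloring_def by blast
  show "agrees_across (\<lambda>a. c (reg a)) a"
    unfolding agrees_across_def by (simp only: reg_rot arev_arev simp_thms)
qed

lemma coloring_eqI:
  assumes "c \<in> Z2_colorings G arev rot" "c' \<in> Z2_colorings G arev rot"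
    and "\<And>a. a \<in> arcs G \<Longrightarrow> c (reg a) = c' (reg a)"
  shows "c = c'"
proof (rule PiE_ext)
  show "c \<in> regions G arev rot \<rightarrow>\<^sub>E UNIV" "c' \<in> regions G arev rot \<rightarrow>\<^sub>E UNIV"
    using assms by (auto simp: Z2_colorings_def verts_dual)
qed (use assms in \<open>auto simp: regions_def\<close>)

lemma trivial_coloring_in: "trivial_coloring G arev rot \<in> Z2_colorings G arev rot"
  by (auto simp: Z2_colorings_def trivial_coloring_def verts_dual triangle_def regions_def
      intro!: sum.neutral)

lemma trivial_coloring_reg: "a \<in> arcs G \<Longrightarrow> trivial_coloring G arev rot (reg a) = 0"
  by (simp add: trivial_coloring_def verts_dual reg_in_regions)

lemma coloring_of_corner_coloring:
  assumes s: "corner_coloring s" and agree: "\<And>a. a \<in> arcs G \<Longrightarrow> agrees_across s a"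
  obtains c where "c \<in> Z2_colorings G arev rot" "\<And>a. a \<in> arcs G \<Longrightarrow> c (reg a) = s a"
proof -
  have const: "s b = s a" if a: "a \<in> arcs G" and b: "b \<in> reg a" for a b
  proof -
    obtain n where "b = ((rot \<circ> arev) ^^ n) a"
      using b by (auto simp: region_def orbit_altdef)
    then show ?thesis
      using walk_around_region[OF s a, of n] agree next_funpow_in_arcs[OF a] by blast
  qed
  define c where "c = (\<lambda>R \<in> regions G arev rot. s (SOME b. b \<in> R))"
  have c: "c (reg a) = s a" if "a \<in> arcs G" for a
    using const[OF that] someI[of "\<lambda>b. b \<in> reg a", OF in_reg] that
    by (simp add: c_def reg_in_regions)
  have "(\<Sum>R \<in> triangle G arev rot v. c R) = 0" if v: "v \<in> verts G" for v
  proof -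
    obtain a where "a \<in> arcs G" "tail G a = v" using exists_out_arc[OF v] .
    then show ?thesis
      using sum_triangle[of a c] s by (simp add: c corner_coloring_def)
  qed
  then have "c \<in> Z2_colorings G arev rot"
    by (auto simp: Z2_colorings_def verts_dual c_def)
  then show ?thesis using c that by blast
qed

section \<open>Uniqueness\<close>

text \<open>
  All colorings vanish on an odd region. So a coloring is determined by its value on one neighboring
  region, and if this value is 0, it is the trivial one.
\<close>

lemma nontrivial_coloring_unique:
  assumes a: "a \<in> arcs G" and odd: "odd (card (reg a))"
    and c: "c \<in> Z2_colorings G arev rot" "c \<noteq> trivial_coloring G arev rot"
    and c': "c' \<in> Z2_colorings G arev rot" "c' \<noteq> trivial_coloring G arev rot"
  shows "c = c'"
proof -
  have zero: "d (reg a) = 0" if "d \<in> Z2_colorings G arev rot" for d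
    using odd_region_corner_zero[OF corner_coloring_of_coloring[OF that] a odd] .
  have det: "d = d'" if "d \<in> Z2_colorings G arev rot" "d' \<in> Z2_colorings G arev rot"
    "d (reg (rot a)) = d' (reg (rot a))" for d d'
    using corner_coloring_determined[OF corner_coloring_of_coloring[OF that(1)]
        corner_coloring_of_coloring[OF that(2)] a] that zero[OF that(1)] zero[OF that(2)]
    by (intro coloring_eqI[OF that(1,2)]) simp
  have one: "d (reg (rot a)) = 1"
    if "d \<in> Z2_colorings G arev rot" "d \<noteq> trivial_coloring G arev rot" for d
    using det[OF that(1) trivial_coloring_in] that a
    by (cases "d (reg (rot a))") (auto simp: trivial_coloring_reg)
  show ?thesis
    using det[OF c(1) c'(1)] one[OF c] one[OF c'] by simp
qed

section \<open>A tree and its complement\<close>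

text \<open>
  The edges with exactly one side in \<open>X\<close> form a subgraph \<open>D\<close> of the tree \<open>T\<close>. The number of
  edges of \<open>D\<close> at a vertex is even, because membership in \<open>X\<close> changes an even number of times
  along the cyclic sequence of its corners. A subgraph of a tree with at least one edge has a
  vertex with exactly one edge, so \<open>D\<close> is empty, and membership in
  \<open>X\<close> spreads over the connected graph \<open>G\<close>.
\<close>

lemma cotree_connected:
  assumes tree: "rooted_spanning_tree (verts G) v0 (arcs G) (tail G) (head G) arev parent rank"
    and T: "T = rooted_spanning_tree.tree_arcs (verts G) v0 arev parent"
    and X: "X \<noteq> {}" "X \<subseteq> regions G arev rot"
    and closed: "\<And>a. a \<in> arcs G - T \<Longrightarrow> reg a \<in> X \<Longrightarrow> reg (arev a) \<in> X"
  shows "X = regions G arev rot"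
proof -
  interpret tree: rooted_spanning_tree "verts G" v0 "arcs G" "tail G" "head G" arev parent rank
    by fact
  define D where "D = {a \<in> arcs G. (reg a \<in> X) \<noteq> (reg (arev a) \<in> X)}"
  have D_arev: "arev a \<in> D" if "a \<in> D" for a
    using that by (auto simp: D_def)
  have D_sub: "a \<in> T" if "a \<in> D" for a
    using that closed[of a] closed[of "arev a"] tree.rev_tree_arcs[of "arev a"]
    by (auto simp: D_def T)
  have "D = {}"
  proof (rule ccontr)
    assume "D \<noteq> {}"
    \<comment> \<open>A vertex of maximal rank in \<open>Y\<close> is a leaf of \<open>D\<close>.\<close>
    define Y where "Y = {x \<in> verts G - {v0}. parent x \<in> D}"
    have "Y \<noteq> {}"
    proof -
      obtain a where "a \<in> D" using \<open>D \<noteq> {}\<close> by blast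
      then have "a \<in> T" "arev a \<in> D" by (rule D_sub, rule D_arev)
      then show ?thesis
        using \<open>a \<in> D\<close> by (auto simp: T tree.tree_arcs_def Y_def)
    qed
    moreover have "finite Y" by (simp add: Y_def)
    ultimately obtain x where x: "x \<in> Y" and max: "\<And>y. y \<in> Y \<Longrightarrow> rank y \<le> rank x"
      using Max_in[of "rank ` Y"] Max_ge[of "rank ` Y"] by (metis (no_types, lifting)
          finite_imageI image_iff image_is_empty)
    let ?b = "arev (parent x)"
    have b: "?b \<in> arcs G" "?b \<in> D" "tail G ?b = x"
      using x tree.parent_in[of x] tree.h_parent[of x] D_arev by (auto simp: Y_def)
    have only: "a = ?b" if "a \<in> D" "tail G a = x" for a
      using D_sub[OF that(1), unfolded T]
    proof (cases rule: tree.tree_arc_from_cases)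
      case up
      then show ?thesis using that by simp
    next
      case (down y)
      then have "y \<in> Y" using that by (simp add: Y_def)
      then show ?thesis using max[of y] down that by simp
    qed
    have "rot ?b \<notin> D" "rot (rot ?b) \<notin> D"
      using only[of "rot ?b"] only[of "rot (rot ?b)"] b corners(3,4)[OF b(1)]
      by (auto simp: tail_rot)
    then have "(reg (rot ?b) \<in> X) = (reg (rot (rot ?b)) \<in> X)"
        "(reg (rot (rot ?b)) \<in> X) = (reg (rot (rot (rot ?b))) \<in> X)"
      using b(1) by (simp_all add: D_def flip: reg_rot)
    moreover have "(reg ?b \<in> X) \<noteq> (reg (rot ?b) \<in> X)"
      using b(2) unfolding D_def by (simp add: reg_rot)
    ultimately show False
      by (simp only: corners(2)[OF b(1)])
  qed
  then have same: "reg (rot a) \<in> X \<longleftrightarrow> reg a \<in> X" "reg (arev a) \<in> X \<longleftrightarrow> reg a \<in> X"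
    if "a \<in> arcs G" for a
    using that unfolding D_def reg_rot by blast+
  obtain a0 where a0: "a0 \<in> arcs G" "reg a0 \<in> X"
    using X by (auto simp: regions_def)
  have "reg a \<in> X" if a: "a \<in> arcs G" for a
  proof -
    have "\<forall>y \<in> out_arcs G (tail G a). reg y \<in> X"
    proof (rule connected_induct[where P = "\<lambda>v. \<forall>y \<in> out_arcs G v. reg y \<in> X"])
      show "\<forall>y \<in> out_arcs G (tail G a0). reg y \<in> X"
        using a0 by (simp add: corners(1) same)
      fix x assume x: "x \<in> arcs G" "\<forall>y \<in> out_arcs G (tail G x). reg y \<in> X"
      then have "reg (arev x) \<in> X" by (simp add: same)
      then show "\<forall>y \<in> out_arcs G (head G x). reg y \<in> X"
        using x(1) corners(1)[of "arev x"] by (simp add: same)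
    qed (use a a0 in simp_all)
    then show ?thesis using a by simp
  qed
  then show ?thesis using X(2) by (auto simp: regions_def)
qed

text \<open>
  By the Euler formula a spanning tree of \<open>G\<close> and a disjoint one of the regions together have
  \<open>(V - 1) + (F - 1) = E\<close> edges, so they exhaust the edges of \<open>G\<close>.
\<close>

lemma tree_cotree:
  assumes v0: "v0 \<in> verts G" and p: "p \<in> regions G arev rot"
  obtains parent rank parent' rank' where
    "rooted_spanning_tree (verts G) v0 (arcs G) (tail G) (head G) arev parent rank"
    "rooted_spanning_tree (regions G arev rot) p (arcs G) reg (\<lambda>a. reg (arev a)) arev parent' rank'"
    "arcs G = rooted_spanning_tree.tree_arcs (verts G) v0 arev parent \<union>
      rooted_spanning_tree.tree_arcs (regions G arev rot) p arev parent'"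
proof -
  let ?F = "regions G arev rot"
  have "\<exists>parent rank. rooted_spanning_tree (verts G) v0 (arcs G) (tail G) (head G) arev parent rank"
  proof (rule rooted_spanning_tree_exists)
    fix X assume "v0 \<in> X" "X \<subseteq> verts G" "\<And>a. a \<in> arcs G \<Longrightarrow> tail G a \<in> X \<Longrightarrow> head G a \<in> X"
    then show "X = verts G"
      using connected_induct[OF v0, of "\<lambda>v. v \<in> X"] by blast
  qed (use v0 in simp_all)
  then obtain parent rank where
    tree: "rooted_spanning_tree (verts G) v0 (arcs G) (tail G) (head G) arev parent rank"
    by blast
  interpret tree: rooted_spanning_tree "verts G" v0 "arcs G" "tail G" "head G" arev parent rank
    by fact
  let ?T = tree.tree_arcs
  have "\<exists>parent' rank'. rooted_spanning_tree ?F p (arcs G - ?T) reg (\<lambda>a. reg (arev a)) arev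
      parent' rank'"
  proof (rule rooted_spanning_tree_exists)
    fix a assume "a \<in> arcs G - ?T"
    then show "arev a \<in> arcs G - ?T"
      using tree.rev_tree_arcs[of "arev a"] by auto
  next
    fix X assume "p \<in> X" "X \<subseteq> ?F"
      "\<And>a. a \<in> arcs G - ?T \<Longrightarrow> reg a \<in> X \<Longrightarrow> reg (arev a) \<in> X"
    then show "X = ?F"
      by (intro cotree_connected[OF tree refl]) auto
  qed (use p in \<open>simp_all add: finite_regions reg_in_regions\<close>)
  then obtain parent' rank' where
    co: "rooted_spanning_tree ?F p (arcs G - ?T) reg (\<lambda>a. reg (arev a)) arev parent' rank'"
    by blast
  interpret co: rooted_spanning_tree ?F p "arcs G - ?T" reg "\<lambda>a. reg (arev a)" arev parent' rank'
    by fact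
  let ?T' = co.tree_arcs
  have "card (?T \<union> ?T') = card ?T + card ?T'"
    using tree.tree_arcs_subset co.tree_arcs_subset finite_arcs
    by (intro card_Un_disjoint) (auto intro: finite_subset)
  moreover have "card (verts G) > 0" "card ?F > 0"
    using v0 p finite_regions by (auto simp: card_gt_0_iff)
  ultimately have "card (?T \<union> ?T') = card (arcs G)"
    using euler_characteristic by (simp add: tree.card_tree_arcs co.card_tree_arcs card_arcs)
  then have "arcs G = ?T \<union> ?T'"
    using tree.tree_arcs_subset co.tree_arcs_subset
    by (intro card_subset_eq[symmetric]) auto
  moreover have "rooted_spanning_tree ?F p (arcs G) reg (\<lambda>a. reg (arev a)) arev parent' rank'"
    using co.parent_in co.h_parent co.t_parent co.rank_parent
    by unfold_locales (auto simp: finite_regions p)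
  ultimately show ?thesis
    using that tree by blast
qed

section \<open>Existence\<close>

text \<open>
  With colors \<open>(0, 1, 1)\<close> at every vertex, a coloring of corners is the choice of one corner \<open>z v\<close>
  at each vertex \<open>v\<close>. Transport across an edge is then a bijection between the corners at its ends,
  and no transported coloring can become trivial.
\<close>

lemma zero_corner_along_tree:
  assumes tree: "rooted_spanning_tree (verts G) v0 (arcs G) (tail G) (head G) arev parent rank"
    and a0: "a0 \<in> arcs G" "tail G a0 = v0"
  obtains s where "corner_coloring s" "s a0 = 0" "s (rot a0) = 1"
    "\<And>a. a \<in> rooted_spanning_tree.tree_arcs (verts G) v0 arev parent \<Longrightarrow> agrees_across s a"
proof -
  interpret tree: rooted_spanning_tree "verts G" v0 "arcs G" "tail G" "head G" arev parent rank
    by fact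
  \<comment> \<open>The two corners along the edge go to the corners of the same regions at the head, and the
    opposite corner goes to the opposite corner.\<close>
  define carry where "carry = (\<lambda>e b. if b = e then rot (arev e) else
    if b = rot e then arev e else rot (rot (arev e)))"
  obtain z where z0: "z v0 = a0"
    and z: "\<And>x. x \<in> verts G - {v0} \<Longrightarrow> z x = carry (parent x) (z (tail G (parent x)))"
    using tree.tree_recursion[of a0 "\<lambda>x. carry (parent x)"] by blast
  have z_arc: "z x \<in> arcs G \<and> tail G (z x) = x" if "x \<in> verts G" for x
  proof (cases "x = v0")
    case False
    then have "parent x \<in> arcs G" "head G (parent x) = x" 
      using that tree.parent_in tree.h_parent by auto
    then show ?thesis
      using that False by (simp add: z carry_def tail_rot)
  qed (use a0 z0 in simp)
  define s where "s = (\<lambda>a. of_bool (z (tail G a) \<noteq> a) :: bit)"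
  have "corner_coloring s"
    unfolding corner_coloring_def
  proof
    fix a assume a: "a \<in> arcs G"
    have "z (tail G a) \<in> out_arcs G (tail G a)"
      using z_arc a by simp
    then show "s a + s (rot a) + s (rot (rot a)) = 0"
      using corners[OF a] a by (auto simp: s_def tail_rot)
  qed
  moreover have "agrees_across s (parent x)" if x: "x \<in> verts G - {v0}" for x
  proof -
    let ?e = "parent x"
    have e: "?e \<in> arcs G" "arev ?e \<in> arcs G" "head G ?e = x"
      using x tree.parent_in tree.h_parent by auto
    show ?thesis
      using corners(3-5)[OF e(1)] corners(3-5)[OF e(2)] e
      by (auto simp: agrees_across_def s_def tail_rot z[OF x] carry_def)
  qed
  then have "agrees_across s a" if "a \<in> tree.tree_arcs" for a
    using that agrees_across_arev unfolding tree.tree_arcs_def by blast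
  moreover have "s a0 = 0" "s (rot a0) = 1"
    using a0 corners(3)[of a0] by (auto simp: s_def tail_rot z0)
  ultimately show ?thesis using that by blast
qed

text \<open>
  The regions other than the root \<open>p\<close> are treated in the order of decreasing rank in the second
  tree, so that only the edge of a region to its parent is open when the region is treated.
\<close>

lemma nontrivial_coloring_exists:
  assumes a0: "a0 \<in> arcs G" and p: "p \<in> regions G arev rot"
    and even: "\<And>a. a \<in> arcs G \<Longrightarrow> reg a \<noteq> p \<Longrightarrow> reg a \<noteq> reg a0 \<Longrightarrow> even (card (reg a))"
  shows "\<exists>c \<in> Z2_colorings G arev rot. c \<noteq> trivial_coloring G arev rot"
proof -
  have "tail G a0 \<in> verts G" using a0 by simp
  then obtain parent rank parent' rank' where
    tree: "rooted_spanning_tree (verts G) (tail G a0) (arcs G) (tail G) (head G) arev parent rank"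
    and co: "rooted_spanning_tree (regions G arev rot) p (arcs G) reg (\<lambda>a. reg (arev a)) arev
      parent' rank'"
    and cover: "arcs G = rooted_spanning_tree.tree_arcs (verts G) (tail G a0) arev parent \<union>
      rooted_spanning_tree.tree_arcs (regions G arev rot) p arev parent'"
    using p by (rule tree_cotree)
  interpret co: rooted_spanning_tree "regions G arev rot" p "arcs G" reg "\<lambda>a. reg (arev a)" arev
    parent' rank'
    by fact
  obtain s where s: "corner_coloring s" "s a0 = 0" "s (rot a0) = 1"
    and s_tree: "\<And>a. a \<in> rooted_spanning_tree.tree_arcs (verts G) (tail G a0) arev parent \<Longrightarrow>
      agrees_across s a"
    using zero_corner_along_tree[OF tree a0 refl] by blast
  have co_agrees: "agrees_across s (parent' R)" if "R \<in> regions G arev rot - {p}" for R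
    using that
  proof (induction "Max (rank' ` regions G arev rot) - rank' R" arbitrary: R rule: less_induct)
    case less
    \<comment> \<open>The parent arc leads to \<open>R\<close>, so its reverse is the arc of this edge that has \<open>R\<close> as its
      own region.\<close>
    let ?a = "arev (parent' R)"
    have a: "?a \<in> arcs G" "reg ?a = R"
      using less.prems co.parent_in co.h_parent by auto
    have "agrees_across s ?a"
    proof (rule close_up_region[OF s(1) a(1)])
      show "even (card (reg ?a)) \<or> (\<exists>b \<in> reg ?a. s b = 0)"
      proof (cases "R = reg a0")
        \<comment> \<open>The region that may be odd: its corner \<open>a0\<close> has color 0 by the choice at the root of the
          tree.\<close>
        case True
        then show ?thesis using s(2) in_reg a(2) by metis
      next
        case False
        then show ?thesis using even[OF a(1)] a(2) less.prems by simp
      qed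
      fix b assume "b \<in> reg ?a" "b \<noteq> ?a"
      then have b: "b \<in> arcs G" "reg b = R"
        using reg_subset[OF a(1)] a(2) reg_eq_iff by blast+
      show "agrees_across s b"
      proof (cases "b \<in> co.tree_arcs")
        case False
        then show ?thesis using s_tree cover b by blast
      next
        case True
        then show ?thesis
        proof (cases rule: co.tree_arc_from_cases)
          case up
          then show ?thesis using b \<open>b \<noteq> ?a\<close> by simp
        next
          case (down R')
          then have "rank' R < rank' R'" "rank' R' \<le> Max (rank' ` regions G arev rot)"
            using b by (auto simp: finite_regions)
          then show ?thesis using less.hyps[of R'] down by simp
        qed
      qed
    qed
    then show ?case by (simp add: agrees_across_arev)
  qed
  have "agrees_across s a" if "a \<in> arcs G" for a
    using that cover s_tree co_agrees agrees_across_arev unfolding co.tree_arcs_def by blast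
  then obtain c where c: "c \<in> Z2_colorings G arev rot" "\<And>a. a \<in> arcs G \<Longrightarrow> c (reg a) = s a"
    using coloring_of_corner_coloring[OF s(1)] by blast
  have "c (reg (rot a0)) \<noteq> trivial_coloring G arev rot (reg (rot a0))"
    using c(2)[of "rot a0"] s(3) a0 by (simp add: trivial_coloring_reg)
  then show ?thesis using c(1) by metis
qed

end

theorem proposition4p1:
  fixes G :: "('a, 'b) pre_digraph" and arev rot :: "'b \<Rightarrow> 'b"
  assumes "sphere_triangulation G arev rot"
    and "card (odd_vertices G arev rot) = 2"
  shows "\<exists>!c. c \<in> Z2_colorings G arev rot \<and> c \<noteq> trivial_coloring G arev rot"
proof -
  interpret sphere_triangulation G arev rot by fact
  obtain p q where pq: "odd_vertices G arev rot = {p, q}"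
    using assms(2) by (auto simp: card_2_iff)
  then have "q \<in> odd_vertices G arev rot" by simp
  then obtain a0 where a0: "a0 \<in> arcs G" "q = reg a0"
    by (auto simp: odd_vertices_def verts_dual regions_def)
  have p: "p \<in> regions G arev rot"
    using pq by (auto simp: odd_vertices_def verts_dual)
  have "even (card (reg a))" if "a \<in> arcs G" "reg a \<noteq> p" "reg a \<noteq> reg a0" for a
    using that odd_vertices_iff[of a] pq a0 by auto
  then have "\<exists>c \<in> Z2_colorings G arev rot. c \<noteq> trivial_coloring G arev rot"
    by (rule nontrivial_coloring_exists[OF a0(1) p])
  moreover have "odd (card (reg a0))"
    using odd_vertices_iff[of a0] pq a0 by simp
  ultimately show ?thesis
    using nontrivial_coloring_unique[OF a0(1)] by blast
qed

end
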